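(* Let $A$ be a non-split, non-Lie, nilpotent (left) Leibniz algebra over $\mathbb{C}$ of dimension $4$ with $\dim(A^2)=1$. Then $A$ is isomorphic to a Leibniz algebra with basis $\{x_1,x_2,x_3,x_4\}$ whose nonzero products of basis vectors are given by one of the following: (1) $[x_1,x_3]=x_4,\ [x_3,x_2]=x_4$. (2) $[x_1,x_3]=x_4,\ [x_2,x_2]=x_4,\ [x_2,x_3]=x_4,\ [x_3,x_1]=x_4,\ [x_3,x_2]=-x_4$. (3) $[x_1,x_2]=x_4,\ [x_2,x_1]=-x_4,\ [x_3,x_3]=x_4$. (4) $[x_1,x_2]=x_4,\ [x_2,x_1]=-x_4,\ [x_2,x_2]=x_4,\ [x_3,x_3]=x_4$. (5) $[x_1,x_2]=x_4,\ [x_2,x_1]=cx_4,\ [x_3,x_3]=x_4$, for some $c\in\mathbb{C}\setminus\{1,-1\}$. (6) $[x_1,x_1]=x_4,\ [x_2,x_2]=x_4,\ [x_3,x_3]=x_4$.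
   Context: All algebras are over $\mathbb{C}$. A (left) Leibniz algebra is a $\mathbb{C}$-vector space $A$ with a bilinear product $[\,,\,]:A\times A\to A$ such that $[a,[b,c]]=[[a,b],c]+[b,[a,c]]$ for all $a,b,c\in A$. $A$ is a Lie algebra iff $Leib(A)=\mathrm{span}\{[a,a]\mid a\in A\}$ is zero; non-Lie means $Leib(A)\neq 0$. Put $A^1=A$, $A^i=[A,A^{i-1}]$ (span of products) for $i\ge 2$; $A$ is nilpotent if $A^m=0$ for some positive integer $m$. $A$ is split if it is a direct sum of two nontrivial (nonzero) ideals (two-sided), and non-split otherwise. Products of basis vectors not listed are zero (products listed with a coefficient $c$ are zero when $c=0$). *)

theory Defs
  imports "HOL-Analysis.Analysis"
begin

text \<open>Left Leibniz algebras over the complex numbers, with the whole type \<open>'a\<close> as underlying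
  vector space; \<open>scale\<close> is the scalar multiplication and \<open>br\<close> the product.\<close>

locale leibniz_algebra = vector_space scale
  for scale :: "complex \<Rightarrow> 'a::ab_group_add \<Rightarrow> 'a" +
  fixes br :: "'a \<Rightarrow> 'a \<Rightarrow> 'a"
  assumes linear_right: "\<And>a. Vector_Spaces.linear scale scale (\<lambda>b. br a b)"
    and linear_left: "\<And>b. Vector_Spaces.linear scale scale (\<lambda>a. br a b)"
    and leibniz: "\<And>a b c. br a (br b c) = br (br a b) c + br b (br a c)"
begin

definition Leib :: "'a set" where
  "Leib = span {br a a |a. True}"

definition lie :: bool where
  "lie \<longleftrightarrow> Leib = {0}"

text \<open>The series is indexed from \<open>1\<close>; the value at \<open>0\<close> is an unused convention.\<close>

fun lower_central :: "nat \<Rightarrow> 'a set" where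
  "lower_central 0 = UNIV"
| "lower_central (Suc 0) = UNIV"
| "lower_central (Suc (Suc n)) = span {br a b |a b. b \<in> lower_central (Suc n)}"

definition nilpotent :: bool where
  "nilpotent \<longleftrightarrow> (\<exists>m\<ge>1. lower_central m = {0})"

definition ideal :: "'a set \<Rightarrow> bool" where
  "ideal I \<longleftrightarrow> subspace I \<and> (\<forall>a. \<forall>i\<in>I. br a i \<in> I \<and> br i a \<in> I)"

definition split :: bool where
  "split \<longleftrightarrow> (\<exists>I J. ideal I \<and> ideal J \<and> I \<noteq> {0} \<and> J \<noteq> {0} \<and>
     I \<inter> J = {0} \<and> {i + j |i j. i \<in> I \<and> j \<in> J} = UNIV)"

definition basis4 :: "(nat \<Rightarrow> 'a) \<Rightarrow> bool" where
  "basis4 x \<longleftrightarrow> inj_on x {1..4} \<and> independent (x ` {1..4}) \<and> span (x ` {1..4}) = UNIV"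

text \<open>An entry \<open>((i, j), c)\<close> of \<open>t\<close> stands for the product \<open>[x\<^sub>i, x\<^sub>j] = c x\<^sub>4\<close>;
  products of basis vectors without an entry are zero.\<close>

definition has_products :: "(nat \<Rightarrow> 'a) \<Rightarrow> ((nat \<times> nat) \<times> complex) list \<Rightarrow> bool" where
  "has_products x t \<longleftrightarrow> (\<forall>i\<in>{1..4}. \<forall>j\<in>{1..4}.
     br (x i) (x j) = (case map_of t (i, j) of None \<Rightarrow> 0 | Some c \<Rightarrow> scale c (x 4)))"

end

definition leibniz_isomorphic ::
  "(complex \<Rightarrow> 'a::ab_group_add \<Rightarrow> 'a) \<Rightarrow> ('a \<Rightarrow> 'a \<Rightarrow> 'a) \<Rightarrow>
   (complex \<Rightarrow> 'b::ab_group_add \<Rightarrow> 'b) \<Rightarrow> ('b \<Rightarrow> 'b \<Rightarrow> 'b) \<Rightarrow> bool" where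
  "leibniz_isomorphic scaleA brA scaleB brB \<longleftrightarrow>
     (\<exists>f. Vector_Spaces.linear scaleA scaleB f \<and> bij f \<and> (\<forall>a b. f (brA a b) = brB (f a) (f b)))"

end

theory Submission
  imports Defs
begin

text \<open>Nilpotency and \<open>dim A\<^sup>2 = 1\<close> make \<open>A\<^sup>2 = span {z}\<close> central, so the product is
  \<open>[a, b] = f(a, b) z\<close> for a bilinear form \<open>f\<close>. A vector outside \<open>span {z}\<close> in the two-sided
  radical of \<open>f\<close> would split off as an ideal; hence the radical is \<open>span {z}\<close>, and the theorem
  becomes the classification up to congruence of bilinear forms with trivial radical on the
  three-dimensional space \<open>A / A\<^sup>2\<close>. Let \<open>S\<close> and \<open>K\<close> be the symmetric and the alternating part.
  If \<open>K = 0\<close>, an orthonormal basis gives (6). Otherwise the kernel of \<open>K\<close> is spanned by a vector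
  \<open>w\<close>. If \<open>S(w, w) \<noteq> 0\<close>, then \<open>w\<close> splits off orthogonally, and the rank \<open>0\<close>, \<open>1\<close>, \<open>2\<close> of \<open>S\<close> on
  the remaining plane gives (3), (4), (5). If \<open>S(w, w) = 0\<close>, choose \<open>v\<close> with \<open>S(w, v) = 1\<close> and
  \<open>u\<close> orthogonal to \<open>w\<close>; then \<open>S(u, u) \<noteq> 0\<close> gives (2) and \<open>S(u, u) = 0\<close> gives (1).\<close>

section \<open>Bilinear forms with one-dimensional radical\<close>

text \<open>The form stays on the whole space, so that no quotient by \<open>span {z}\<close> has to
  be formed. Only the two-sided radical is prescribed: the left or the right radical alone may be
  larger, as in (5) with c = 0.\<close>

locale radical_form = vector_space scale
  for scale :: "complex \<Rightarrow> 'a::ab_group_add \<Rightarrow> 'a" (infixr \<open>\<cdot>\<close> 75) +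
  fixes f :: "'a \<Rightarrow> 'a \<Rightarrow> complex" and z :: 'a
  assumes add_left: "f (a + b) c = f a c + f b c"
    and scale_left: "f (k \<cdot> a) c = k * f a c"
    and add_right: "f c (a + b) = f c a + f c b"
    and scale_right: "f c (k \<cdot> a) = k * f c a"
    and radical: "(\<forall>a. f v a = 0 \<and> f a v = 0) \<longleftrightarrow> v \<in> span {z}"
    and z_nonzero: "z \<noteq> 0"
    and dim_UNIV: "dim (UNIV :: 'a set) = 4"
begin

lemma zero_left: "f 0 c = 0"
  using scale_left[of 0 0 c] by simp

lemma zero_right: "f c 0 = 0"
  using scale_right[of c 0 0] by simp

lemma minus_left: "f (- a) c = - f a c"
  using scale_left[of "-1" a c] by simp

lemma minus_right: "f c (- a) = - f c a"
  using scale_right[of c "-1" a] by simp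

lemma diff_left: "f (a - b) c = f a c - f b c"
  using add_left[of a "- b" c] by (simp add: minus_left)

lemma diff_right: "f c (a - b) = f c a - f c b"
  using add_right[of c a "- b"] by (simp add: minus_right)

lemma z_left: "f z a = 0" and z_right: "f a z = 0"
  using radical[of z] by (auto simp: span_base)

lemmas bilinear_simps = add_left scale_left add_right scale_right zero_left zero_right
  minus_left minus_right diff_left diff_right z_left z_right

section \<open>Bases ending in the radical vector\<close>

lemma independent_spanning:
  assumes "independent S" "card S = 4"
  shows "span S = UNIV"
proof -
  obtain B where B: "independent B" "UNIV \<subseteq> span B" "card B = 4"
    using basis_exists[of UNIV] dim_UNIV by metis
  \<comment> \<open>An infinite set has \<open>card\<close> 0, so the value 4 forces
    finiteness.\<close>
  have "finite B" using B(3) card.infinite by fastforce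
  then interpret fd: finite_dimensional_vector_space scale B
    using B by unfold_locales auto
  show ?thesis
    using fd.card_ge_dim_independent[of S UNIV] assms dim_UNIV by auto
qed

lemma span3_neq_UNIV: "span {a, b, c} \<noteq> UNIV"
proof
  assume *: "span {a, b, c} = UNIV"
  have "dim UNIV \<le> card {a, b, c}" by (rule dim_le_card) (auto simp: *)
  moreover have "card {a, b, c} \<le> 3" by (simp add: card_insert_if)
  ultimately show False using dim_UNIV by simp
qed

definition frame :: "'a \<Rightarrow> 'a \<Rightarrow> 'a \<Rightarrow> nat \<Rightarrow> 'a" where
  "frame x1 x2 x3 = (\<lambda>i. if i = 1 then x1 else if i = 2 then x2 else if i = 3 then x3 else z)"

lemma atLeastAtMost_1_4: "{1..4} = {1, 2, 3, 4 :: nat}"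
  by auto

lemma radical_left: "v \<in> span {z} \<Longrightarrow> f v a = 0"
  and radical_right: "v \<in> span {z} \<Longrightarrow> f a v = 0"
  using radical[of v] by auto

text \<open>Repeats \<open>basis4\<close>, which belongs to the locale of Leibniz algebras, for a
  space that carries only a form.\<close>

definition basis :: "(nat \<Rightarrow> 'a) \<Rightarrow> bool" where
  "basis x \<longleftrightarrow> inj_on x {1..4} \<and> independent (x ` {1..4}) \<and> span (x ` {1..4}) = UNIV"

text \<open>Independence is read off the Gram matrix of the final vectors and need not be carried along
  the changes of basis.\<close>

lemma basis_frame:
  assumes "\<And>a b c. (\<And>y. f (a \<cdot> x1 + b \<cdot> x2 + c \<cdot> x3) y = 0) \<Longrightarrow>
    (\<And>y. f y (a \<cdot> x1 + b \<cdot> x2 + c \<cdot> x3) = 0) \<Longrightarrow> a = 0 \<and> b = 0 \<and> c = 0"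
  shows "basis (frame x1 x2 x3)"
proof -
  have *: "a = 0 \<and> b = 0 \<and> c = 0" if "a \<cdot> x1 + b \<cdot> x2 + c \<cdot> x3 \<in> span {z}" for a b c
    using assms[of a b c] radical_left[OF that] radical_right[OF that] by blast
  have 3: "x3 \<notin> span {z}" using *[of 0 0 1] by auto
  have 2: "x2 \<notin> span {x3, z}"
  proof
    assume "x2 \<in> span {x3, z}"
    then obtain k where "x2 - k \<cdot> x3 \<in> span {z}" by (auto simp: span_breakdown_eq)
    then show False using *[of 0 1 "- k"] by auto
  qed
  have 1: "x1 \<notin> span {x2, x3, z}"
  proof
    assume "x1 \<in> span {x2, x3, z}"
    then obtain k l where "x1 - k \<cdot> x2 - l \<cdot> x3 \<in> span {z}"
      by (auto simp: span_breakdown_eq[of x1] span_breakdown_eq[of _ x3])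
    then show False using *[of 1 "- k" "- l"] by (auto simp: algebra_simps)
  qed
  have ind: "independent {x1, x2, x3, z}"
    by (intro independent_insertI 1 2 3) (simp_all add: z_nonzero independent_empty)
  have ne: "x1 \<noteq> x2" "x1 \<noteq> x3" "x1 \<noteq> z" "x2 \<noteq> x3" "x2 \<noteq> z" "x3 \<noteq> z"
    using 1 2 3 by (auto intro: span_base)
  have im: "frame x1 x2 x3 ` {1..4} = {x1, x2, x3, z}"
    unfolding atLeastAtMost_1_4 frame_def by auto
  have "card {x1, x2, x3, z} = 4" using ne by simp
  moreover have "inj_on (frame x1 x2 x3) {1..4}"
    using ne unfolding atLeastAtMost_1_4 frame_def by (auto simp: inj_on_def)
  ultimately show ?thesis
    unfolding basis_def using ind im independent_spanning by simp
qed

section \<open>Normal forms as Gram matrices\<close>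

definition represents :: "(nat \<Rightarrow> 'a) \<Rightarrow> ((nat \<times> nat) \<times> complex) list \<Rightarrow> bool" where
  "represents x t \<longleftrightarrow> basis x \<and> x 4 = z \<and> (\<forall>i\<in>{1..4}. \<forall>j\<in>{1..4}.
     f (x i) (x j) = (case map_of t (i, j) of None \<Rightarrow> 0 | Some c \<Rightarrow> c))"

text \<open>Since \<open>z\<close> lies in the radical, only the nine entries among
  \<open>x1\<close>, \<open>x2\<close>, \<open>x3\<close> carry information; the last two premises
  make the table vanish in row and column 4.\<close>

lemma representsI:
  fixes t :: "((nat \<times> nat) \<times> complex) list"
  defines "m \<equiv> (\<lambda>i j. case map_of t (i, j) of None \<Rightarrow> 0 | Some c \<Rightarrow> c)"
  assumes "basis (frame x1 x2 x3)"
    and "f x1 x1 = m 1 1" "f x1 x2 = m 1 2" "f x1 x3 = m 1 3"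
    and "f x2 x1 = m 2 1" "f x2 x2 = m 2 2" "f x2 x3 = m 2 3"
    and "f x3 x1 = m 3 1" "f x3 x2 = m 3 2" "f x3 x3 = m 3 3"
    and "\<And>i. m i 4 = 0" "\<And>i. m 4 i = 0"
  shows "represents (frame x1 x2 x3) t"
proof -
  have "\<forall>i\<in>{1..4}. \<forall>j\<in>{1..4}. f (frame x1 x2 x3 i) (frame x1 x2 x3 j) = m i j"
    unfolding atLeastAtMost_1_4 using assms(3-) by (simp add: frame_def z_left z_right)
  then show ?thesis unfolding represents_def m_def using assms(2) by (simp add: frame_def)
qed

text \<open>The numbers are those of the multiplication tables in the theorem; table 3 is
  \<open>represents_5\<close> with \<open>e = -1\<close>.\<close>

lemma represents_1:
  assumes "f x1 x1 = 0" "f x1 x2 = 0" "f x1 x3 = 1" "f x2 x1 = 0" "f x2 x2 = 0" "f x2 x3 = 0"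
    "f x3 x1 = 0" "f x3 x2 = 1" "f x3 x3 = 0"
  shows "represents (frame x1 x2 x3) [((1,3), 1), ((3,2), 1)]"
proof (intro representsI basis_frame)
  fix a b c
  assume l: "\<And>y. f (a \<cdot> x1 + b \<cdot> x2 + c \<cdot> x3) y = 0" and r: "\<And>y. f y (a \<cdot> x1 + b \<cdot> x2 + c \<cdot> x3) = 0"
  show "a = 0 \<and> b = 0 \<and> c = 0"
    using l[of x3] r[of x3] l[of x2] r[of x2] l[of x1] r[of x1] assms by (simp add: bilinear_simps)
qed (use assms in simp_all)

lemma represents_2:
  assumes "f x1 x1 = 0" "f x1 x2 = 0" "f x1 x3 = 1" "f x2 x1 = 0" "f x2 x2 = 1" "f x2 x3 = 1"
    "f x3 x1 = 1" "f x3 x2 = -1" "f x3 x3 = 0"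
  shows "represents (frame x1 x2 x3) [((1,3), 1), ((2,2), 1), ((2,3), 1), ((3,1), 1), ((3,2), -1)]"
proof (intro representsI basis_frame)
  fix a b c
  assume l: "\<And>y. f (a \<cdot> x1 + b \<cdot> x2 + c \<cdot> x3) y = 0" and r: "\<And>y. f y (a \<cdot> x1 + b \<cdot> x2 + c \<cdot> x3) = 0"
  show "a = 0 \<and> b = 0 \<and> c = 0"
    using l[of x3] r[of x3] l[of x2] r[of x2] l[of x1] r[of x1] assms by (simp add: bilinear_simps)
qed (use assms in simp_all)

lemma represents_4:
  assumes "f x1 x1 = 0" "f x1 x2 = 1" "f x1 x3 = 0" "f x2 x1 = -1" "f x2 x2 = 1" "f x2 x3 = 0"
    "f x3 x1 = 0" "f x3 x2 = 0" "f x3 x3 = 1"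
  shows "represents (frame x1 x2 x3) [((1,2), 1), ((2,1), -1), ((2,2), 1), ((3,3), 1)]"
proof (intro representsI basis_frame)
  fix a b c
  assume l: "\<And>y. f (a \<cdot> x1 + b \<cdot> x2 + c \<cdot> x3) y = 0" and r: "\<And>y. f y (a \<cdot> x1 + b \<cdot> x2 + c \<cdot> x3) = 0"
  have "b = 0" using r[of x1] assms by (simp add: bilinear_simps)
  moreover have "c = 0" using r[of x3] assms by (simp add: bilinear_simps)
  ultimately show "a = 0 \<and> b = 0 \<and> c = 0" using l[of x2] assms by (simp add: bilinear_simps)
qed (use assms in simp_all)

lemma represents_5:
  assumes "f x1 x1 = 0" "f x1 x2 = 1" "f x1 x3 = 0" "f x2 x1 = e" "f x2 x2 = 0" "f x2 x3 = 0"
    "f x3 x1 = 0" "f x3 x2 = 0" "f x3 x3 = 1"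
  shows "represents (frame x1 x2 x3) [((1,2), 1), ((2,1), e), ((3,3), 1)]"
proof (intro representsI basis_frame)
  fix a b c
  assume l: "\<And>y. f (a \<cdot> x1 + b \<cdot> x2 + c \<cdot> x3) y = 0" and r: "\<And>y. f y (a \<cdot> x1 + b \<cdot> x2 + c \<cdot> x3) = 0"
  \<comment> \<open>Pairing with \<open>x1\<close> from the left and with \<open>x2\<close> from the
    right meets only the entry 1, never \<open>e\<close>, so \<open>e\<close> may be any number,
    including 0.\<close>
  have "b = 0" using r[of x1] assms by (simp add: bilinear_simps)
  moreover have "c = 0" using r[of x3] assms by (simp add: bilinear_simps)
  ultimately show "a = 0 \<and> b = 0 \<and> c = 0" using l[of x2] assms by (simp add: bilinear_simps)
qed (use assms in simp_all)

lemma represents_6: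
  assumes "f x1 x1 = 1" "f x1 x2 = 0" "f x1 x3 = 0" "f x2 x1 = 0" "f x2 x2 = 1" "f x2 x3 = 0"
    "f x3 x1 = 0" "f x3 x2 = 0" "f x3 x3 = 1"
  shows "represents (frame x1 x2 x3) [((1,1), 1), ((2,2), 1), ((3,3), 1)]"
proof (intro representsI basis_frame)
  fix a b c
  assume l: "\<And>y. f (a \<cdot> x1 + b \<cdot> x2 + c \<cdot> x3) y = 0" and r: "\<And>y. f y (a \<cdot> x1 + b \<cdot> x2 + c \<cdot> x3) = 0"
  show "a = 0 \<and> b = 0 \<and> c = 0"
    using l[of x3] r[of x3] l[of x2] r[of x2] l[of x1] r[of x1] assms by (simp add: bilinear_simps)
qed (use assms in simp_all)

definition classified :: bool where
  "classified \<longleftrightarrow> (\<exists>x. represents x [((1,3), 1), ((3,2), 1)] \<or>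
     represents x [((1,3), 1), ((2,2), 1), ((2,3), 1), ((3,1), 1), ((3,2), -1)] \<or>
     represents x [((1,2), 1), ((2,1), -1), ((3,3), 1)] \<or>
     represents x [((1,2), 1), ((2,1), -1), ((2,2), 1), ((3,3), 1)] \<or>
     (\<exists>c. c \<notin> {1, -1} \<and> represents x [((1,2), 1), ((2,1), c), ((3,3), 1)]) \<or>
     represents x [((1,1), 1), ((2,2), 1), ((3,3), 1)])"

section \<open>Reduction of the form by congruence\<close>

lemma complex_quadratic_root:
  fixes a b c :: complex
  assumes "a \<noteq> 0"
  obtains r where "a * r\<^sup>2 + b * r + c = 0"
proof -
  define r where "r = (csqrt (b\<^sup>2 - 4 * a * c) - b) / (2 * a)"
  have "2 * a * r + b = csqrt (b\<^sup>2 - 4 * a * c)" using assms by (simp add: r_def)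
  then have "(2 * a * r + b)\<^sup>2 = b\<^sup>2 - 4 * a * c" by simp
  then have "4 * a * (a * r\<^sup>2 + b * r + c) = 0" by (simp add: algebra_simps power2_eq_square)
  then show thesis using that[of r] assms by simp
qed

text \<open>As \<open>w\<close> is split off, only the plane of \<open>x\<close> and
  \<open>y\<close> matters. If \<open>f x y + f y x\<close> is nonzero, \<open>y\<close> can be made
  isotropic as well, and the ratio of the two mixed values is the parameter of (5). If it is zero,
  \<open>f y y\<close> decides between (3) and (4).\<close>

lemma classified_isotropic_plane:
  assumes w: "f w w = 1" "f w x = 0" "f x w = 0" "f w y = 0" "f y w = 0"
    and x: "f x x = 0" and xy: "f x y \<noteq> f y x"
  shows classified
proof (cases "f x y + f y x = 0")
  case False
  define s where "s = f x y + f y x"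
  \<comment> \<open>Since \<open>x\<close> is isotropic, this shift changes \<open>f y y\<close> by
    a multiple of \<open>s\<close> only, and the multiple is chosen to cancel it.\<close>
  define y' where "y' = y - (f y y / s) \<cdot> x"
  have s: "s \<noteq> 0" using False by (simp add: s_def)
  have y': "f x y' = f x y" "f y' x = f y x" "f w y' = 0" "f y' w = 0"
    using w x by (simp_all add: y'_def bilinear_simps)
  have "f y' y' = f y y - (f y y / s) * (f x y + f y x)"
    using x by (simp add: y'_def bilinear_simps ring_distribs)
  then have y'y': "f y' y' = 0" using s by (simp flip: s_def)
  show ?thesis
  proof (cases "f x y = 0")
    case xy0: False
    \<comment> \<open>The value 1 is excluded by the asymmetry \<open>xy\<close>, the value -1 by
      the nonzero sum.\<close>
    have "f y x / f x y \<noteq> 1" "f y x / f x y \<noteq> -1"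
      using xy0 xy False by (auto simp: field_simps add_eq_0_iff)
    moreover have "represents (frame ((1 / f x y) \<cdot> x) y' w) [((1,2), 1), ((2,1), f y x / f x y), ((3,3), 1)]"
      by (rule represents_5) (use w x y' y'y' xy0 in \<open>simp_all add: bilinear_simps\<close>)
    ultimately show ?thesis unfolding classified_def by blast
  next
    case True
    \<comment> \<open>The ratio has denominator 0 here; with \<open>x\<close> and \<open>y'\<close>
      exchanged it becomes c = 0.\<close>
    have "represents (frame ((1 / f y x) \<cdot> y') x w) [((1,2), 1), ((2,1), 0), ((3,3), 1)]"
      by (rule represents_5) (use w x y' y'y' True xy in \<open>simp_all add: bilinear_simps\<close>)
    moreover have "(0::complex) \<notin> {1, -1}" by simp
    ultimately show ?thesis unfolding classified_def by blast
  qed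
next
  case True
  then have yx: "f y x = - f x y" by (simp add: add_eq_0_iff)
  then have xy0: "f x y \<noteq> 0" using xy by auto
  show ?thesis
  proof (cases "f y y = 0")
    case True
    have "represents (frame ((1 / f x y) \<cdot> x) y w) [((1,2), 1), ((2,1), -1), ((3,3), 1)]"
      by (rule represents_5) (use w x yx True xy0 in \<open>simp_all add: bilinear_simps\<close>)
    then show ?thesis unfolding classified_def by blast
  next
    case False
    define t where "t = csqrt (f y y)"
    have t: "t * t = f y y" "t \<noteq> 0"
      using False by (simp_all add: t_def flip: power2_eq_square)
    have "represents (frame ((t / f x y) \<cdot> x) ((1 / t) \<cdot> y) w)
        [((1,2), 1), ((2,1), -1), ((2,2), 1), ((3,3), 1)]"
      by (rule represents_4) (use w x yx t xy0 False in \<open>simp_all add: bilinear_simps\<close>)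
    then show ?thesis unfolding classified_def by blast
  qed
qed

text \<open>Over the complex numbers the plane of \<open>x\<close> and \<open>y\<close> contains an
  isotropic vector: \<open>x\<close> itself, or \<open>r \<cdot> x + y\<close> for a root
  \<open>r\<close> of a quadratic equation. Such a change of basis keeps the asymmetry.\<close>

lemma classified_nonisotropic_kernel:
  assumes w: "f w w = 1" "f w x = 0" "f x w = 0" "f w y = 0" "f y w = 0"
    and xy: "f x y \<noteq> f y x"
  shows classified
proof (cases "f x x = 0")
  case True
  then show ?thesis using classified_isotropic_plane assms by blast
next
  case False
  then obtain r where r: "f x x * r\<^sup>2 + (f x y + f y x) * r + f y y = 0"
    by (rule complex_quadratic_root)
  show ?thesis
    by (rule classified_isotropic_plane[of w "r \<cdot> x + y" x])
      (use r w xy in \<open>simp_all add: bilinear_simps power2_eq_square algebra_simps\<close>)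
qed

text \<open>Shifts along \<open>w\<close> make \<open>v\<close> isotropic and remove the symmetric
  part of the pairing of \<open>u\<close> with \<open>v\<close>. What remains is the alternating
  value \<open>k\<close> and \<open>f u u\<close>, which decides between (1) and (2).\<close>

lemma classified_isotropic_kernel:
  assumes w: "f w w = 0" "f w v = 1" "f v w = 1" "f w u = 0" "f u w = 0"
    and uv: "f u v \<noteq> f v u"
  shows classified
proof -
  define u' where "u' = u - ((f u v + f v u) / 2) \<cdot> w"
  define v' where "v' = v - (f v v / 2) \<cdot> w"
  define k where "k = (f u v - f v u) / 2"
  have k: "k \<noteq> 0" using uv by (simp add: k_def)
  have w': "f w v' = 1" "f v' w = 1" "f w u' = 0" "f u' w = 0" "f v' v' = 0"
    "f u' u' = f u u"
    using w by (simp_all add: u'_def v'_def bilinear_simps)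
  have uv': "f u' v' = k" "f v' u' = - k"
    using w by (simp_all add: u'_def v'_def k_def bilinear_simps field_simps)
  show ?thesis
  proof (cases "f u u = 0")
    case True
    \<comment> \<open>Against \<open>v'\<close>, the vector \<open>w\<close> has the value 1 on both
      sides, while \<open>(1/k) \<cdot> u'\<close> has 1 on the left and -1 on the right. Half the
      sum thus pairs with \<open>v'\<close> only from the left, half the difference only from the
      right.\<close>
    have "represents (frame ((1/2) \<cdot> (w + (1/k) \<cdot> u')) ((1/2) \<cdot> (w - (1/k) \<cdot> u')) v')
       [((1,3), 1), ((3,2), 1)]"
      by (rule represents_1) (use w w' uv' k True in \<open>simp_all add: bilinear_simps\<close>)
    then show ?thesis unfolding classified_def by blast
  next
    case False
    define t where "t = csqrt (f u u)"
    have t: "t * t = f u u" "t \<noteq> 0"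
      using False by (simp_all add: t_def flip: power2_eq_square)
    \<comment> \<open>The factor \<open>1 / t\<close> normalises \<open>u'\<close>, then
      \<open>t / k\<close> on \<open>v'\<close> turns \<open>k\<close> into 1, and
      \<open>k / t\<close> on \<open>w\<close> compensates.\<close>
    have "represents (frame ((k / t) \<cdot> w) ((1 / t) \<cdot> u') ((t / k) \<cdot> v'))
       [((1,3), 1), ((2,2), 1), ((2,3), 1), ((3,1), 1), ((3,2), -1)]"
      by (rule represents_2) (use w w' uv' k t False in \<open>simp_all add: bilinear_simps\<close>)
    then show ?thesis unfolding classified_def by blast
  qed
qed

lemma classified_nonsymmetric:
  assumes ab: "f a b \<noteq> f b a"
  shows classified
proof -
  define k where "k = f a b - f b a"
  have k: "k \<noteq> 0" using ab by (simp add: k_def)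
  obtain c where c: "c \<notin> span {a, b, z}" using span3_neq_UNIV by blast
  \<comment> \<open>With K(x, y) = \<open>f x y - f y x\<close> and k = K(a, b), the coefficients
    solve K(w, a) = K(w, b) = 0. So \<open>w\<close> lies in the kernel of K, and it stays outside
    \<open>span {a, b, z}\<close> because \<open>c\<close> does.\<close>
  define w where "w = c - ((f c b - f b c) / k) \<cdot> a + ((f c a - f a c) / k) \<cdot> b"
  have "k * f w a = k * f a w" "k * f w b = k * f b w"
    using k unfolding w_def by (simp_all add: bilinear_simps field_simps) (simp_all add: k_def algebra_simps)
  then have wa: "f w a = f a w" and wb: "f w b = f b w" using k by auto
  have w: "w \<notin> span {a, b, z}"
  proof
    assume "w \<in> span {a, b, z}"
    then have "w + ((f c b - f b c) / k) \<cdot> a - ((f c a - f a c) / k) \<cdot> b \<in> span {a, b, z}"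
      by (simp add: span_add span_diff span_scale span_base)
    then show False using c by (simp add: w_def)
  qed
  have b: "b \<notin> span {z}"
    using ab radical_left[of b] radical_right[of b] by auto
  have a: "a \<notin> span {b, z}"
  proof
    assume "a \<in> span {b, z}"
    then obtain l where l: "a - l \<cdot> b \<in> span {z}" by (auto simp: span_breakdown_eq)
    show False
      using ab radical_left[OF l, of b] radical_right[OF l, of b] by (simp add: bilinear_simps)
  qed
  have "independent {w, a, b, z}"
    by (intro independent_insertI w a b) (simp_all add: z_nonzero independent_empty)
  moreover have "card {w, a, b, z} = 4"
    using w a b by (auto simp: card_insert_if intro: span_base)
  ultimately have span: "span {w, a, b, z} = UNIV" by (rule independent_spanning)
  have sym: "f w y = f y w" for y
  proof -
    have "y \<in> span {w, a, b, z}" by (simp add: span)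
    then show ?thesis
      by (induction rule: span_induct_alt) (auto simp: bilinear_simps wa wb)
  qed
  show ?thesis
  proof (cases "f w w = 0")
    case False
    define t where "t = csqrt (f w w)"
    have t: "t * t = f w w" "t \<noteq> 0"
      using False by (simp_all add: t_def flip: power2_eq_square)
    define p where "p x = x - (f w x / f w w) \<cdot> w" for x
    have p: "f w (p x) = 0" "f (p x) w = 0" for x
      using False sym[of x] by (simp_all add: p_def bilinear_simps)
    \<comment> \<open>The correction term is symmetric in \<open>x\<close> and \<open>y\<close>, so
      the projection \<open>p\<close> along \<open>w\<close> preserves the alternating part.\<close>
    have fp: "f (p x) (p y) = f x y - f w x * f w y / f w w" for x y
    proof -
      have "f (p x) (p y) = f (p x) y"
        by (simp add: p_def[of y] bilinear_simps p)
      also have "\<dots> = f x y - f w x * f w y / f w w"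
        by (simp add: p_def bilinear_simps)
      finally show ?thesis .
    qed
    have "f ((1 / t) \<cdot> w) ((1 / t) \<cdot> w) = 1"
      using t(2) by (simp add: bilinear_simps flip: t(1))
    moreover have "f (p a) (p b) \<noteq> f (p b) (p a)" using ab by (simp add: fp mult.commute)
    ultimately show ?thesis
      using classified_nonisotropic_kernel[of "(1 / t) \<cdot> w" "p a" "p b"]
      by (simp add: scale_left scale_right p)
  next
    case ww: True
    \<comment> \<open>Scaling \<open>v\<close> gives it the value 1 against \<open>w\<close>;
      subtracting a multiple of \<open>v\<close> makes \<open>u\<close> orthogonal to
      \<open>w\<close> and keeps the asymmetry.\<close>
    have *: classified if "f w v \<noteq> 0" "f u v \<noteq> f v u" for u v
      by (rule classified_isotropic_kernel[of w "(1 / f w v) \<cdot> v" "u - (f w u / f w v) \<cdot> v"])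
        (simp_all add: bilinear_simps that ww sym[of u, symmetric] sym[of v, symmetric] diff_divide_distrib)
    \<comment> \<open>Otherwise the isotropic vector \<open>w\<close> would be orthogonal to the
      whole basis and fall into the radical.\<close>
    have "f w a \<noteq> 0 \<or> f w b \<noteq> 0"
    proof (rule ccontr)
      assume *: "\<not> ?thesis"
      have "f w y = 0" if "y \<in> span {w, a, b, z}" for y
        using that by (induction rule: span_induct_alt) (use * in \<open>auto simp: bilinear_simps ww\<close>)
      then have "w \<in> span {z}" using radical[of w] sym span by auto
      moreover have "span {z} \<subseteq> span {a, b, z}" by (rule span_mono) auto
      ultimately show False using w by blast
    qed
    then show ?thesis using *[of a b] *[of b a] ab by metis
  qed
qed

text \<open>Admitting \<open>a = 0\<close> and \<open>b = 0\<close> lets one lemma produce all three vectors of an orthonormal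
  basis.\<close>

lemma orthonormal_extend:
  assumes sym: "\<And>x y. f x y = f y x"
    and a: "a = 0 \<or> f a a = 1" and b: "b = 0 \<or> f b b = 1" and ab: "f a b = 0"
  obtains c where "f c c = 1" "f a c = 0" "f b c = 0"
proof -
  define p where "p x = x - f a x \<cdot> a - f b x \<cdot> b" for x
  have pa: "f a (p x) = 0" for x
    using a ab sym[of b a] by (auto simp: p_def bilinear_simps)
  have pb: "f b (p x) = 0" for x
    using b ab sym[of b a] by (auto simp: p_def bilinear_simps)
  obtain c where c: "c \<notin> span {a, b, z}" using span3_neq_UNIV by blast
  have "p c \<notin> span {z}"
  proof
    assume "p c \<in> span {z}"
    then have "p c \<in> span {a, b, z}" using span_mono[of "{z}" "{a, b, z}"] by auto
    then have "p c + f a c \<cdot> a + f b c \<cdot> b \<in> span {a, b, z}"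
      by (simp add: span_add span_scale span_base)
    then show False using c by (simp add: p_def)
  qed
  then obtain d where d: "f (p c) d \<noteq> 0" using radical[of "p c"] sym by metis
  have "f (p c) (p d) = f (p c) d"
    using pa[of c] pb[of c] sym[of "p c" a] sym[of "p c" b] unfolding p_def[of d] by (simp add: bilinear_simps)
  then have "f (p c) (p d) \<noteq> 0" using d by simp
  \<comment> \<open>Polarization: a symmetric form with \<open>f (p c) (p d)\<close> nonzero cannot
    vanish on the diagonal at \<open>p c\<close>, \<open>p d\<close> and \<open>p c + p d\<close> at
    once.\<close>
  moreover have "f (p c + p d) (p c + p d) = f (p c) (p c) + 2 * f (p c) (p d) + f (p d) (p d)"
    using sym[of "p d" "p c"] by (simp add: bilinear_simps)
  ultimately have "f (p c) (p c) \<noteq> 0 \<or> f (p d) (p d) \<noteq> 0 \<or> f (p c + p d) (p c + p d) \<noteq> 0"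
    by auto
  moreover have "f a (p c + p d) = 0" "f b (p c + p d) = 0" using pa pb by (simp_all add: bilinear_simps)
  ultimately obtain e where e: "f e e \<noteq> 0" "f a e = 0" "f b e = 0" using pa pb by blast
  show thesis
  proof
    show "f ((1 / csqrt (f e e)) \<cdot> e) ((1 / csqrt (f e e)) \<cdot> e) = 1"
      using e(1) by (simp add: bilinear_simps flip: power2_eq_square)
  qed (use e in \<open>simp_all add: bilinear_simps\<close>)
qed

lemma classified_symmetric:
  assumes sym: "\<And>x y. f x y = f y x"
  shows classified
proof -
  obtain x1 where x1: "f x1 x1 = 1"
    using orthonormal_extend[OF sym, of 0 0] by (auto simp: bilinear_simps)
  obtain x2 where x2: "f x2 x2 = 1" "f x1 x2 = 0"
    using orthonormal_extend[OF sym, of x1 0] x1 by (auto simp: bilinear_simps)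
  obtain x3 where x3: "f x3 x3 = 1" "f x1 x3 = 0" "f x2 x3 = 0"
    using orthonormal_extend[OF sym, of x1 x2] x1 x2 by auto
  have "represents (frame x1 x2 x3) [((1,1), 1), ((2,2), 1), ((3,3), 1)]"
    by (rule represents_6) (use x1 x2 x3 sym in metis)+
  then show ?thesis unfolding classified_def by blast
qed

theorem classification: classified
  using classified_symmetric classified_nonsymmetric by blast

end

section \<open>The form of a Leibniz algebra\<close>

context leibniz_algebra
begin

lemma br_add_right: "br a (b + c) = br a b + br a c"
  and br_scale_right: "br a (scale k b) = scale k (br a b)"
  and br_zero_right: "br a 0 = 0"
proof -
  interpret l: Vector_Spaces.linear scale scale "\<lambda>b. br a b" by (rule linear_right)
  show "br a (b + c) = br a b + br a c" "br a (scale k b) = scale k (br a b)" "br a 0 = 0"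
    by (simp_all add: l.add l.scale)
qed

lemma br_add_left: "br (a + b) c = br a c + br b c"
  and br_scale_left: "br (scale k a) c = scale k (br a c)"
  and br_zero_left: "br 0 c = 0"
proof -
  interpret l: Vector_Spaces.linear scale scale "\<lambda>a. br a c" by (rule linear_left)
  show "br (a + b) c = br a c + br b c" "br (scale k a) c = scale k (br a c)" "br 0 c = 0"
    by (simp_all add: l.add l.scale)
qed

lemma lower_central_2: "lower_central 2 = span {br a b |a b. True}"
  by (simp add: numeral_2_eq_2)

text \<open>If [a, z] were a nonzero multiple of \<open>z\<close>, then \<open>z\<close> would lie
  in every term of the lower central series. Hence [a, [b, c]] = 0 always, and the Leibniz identity
  leaves [[b, c], a] = 0; as \<open>z\<close> is a combination of products, [z, a] = 0
  follows.\<close>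

lemma br_central:
  assumes nil: nilpotent and z: "z \<noteq> 0" "lower_central 2 = span {z}"
  shows "br a z = 0" "br z a = 0"
proof -
  have br2: "br a b \<in> span {z}" for a b
    unfolding z(2)[symmetric] lower_central_2 by (rule span_base) auto
  show az: "br a z = 0" for a
  proof (rule ccontr)
    assume nz: "br a z \<noteq> 0"
    obtain k where k: "br a z = scale k z"
      using br2[of a z] by (auto simp: span_singleton)
    have "k \<noteq> 0" using nz k by auto
    have "z \<in> lower_central (Suc n)" for n
    proof (induction n)
      case (Suc n)
      have "br a z \<in> lower_central (Suc (Suc n))"
        using Suc by (auto intro!: span_base)
      then have "scale (1 / k) (scale k z) \<in> lower_central (Suc (Suc n))"
        unfolding k lower_central.simps by (rule span_scale)
      then show ?case using \<open>k \<noteq> 0\<close> by simp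
    qed simp
    moreover obtain m where "m \<ge> 1" "lower_central m = {0}"
      using nil unfolding nilpotent_def by blast
    ultimately show False using z(1) by (metis Suc_le_D One_nat_def singletonD)
  qed
  have right0: "br a (br b c) = 0" for a b c
    using br2[of b c] by (auto simp: span_singleton br_scale_right az)
  have "z \<in> span {br a b |a b. True}"
    using lower_central_2 z(2) span_base[of z "{z}"] by auto
  then show "br z a = 0"
  proof (induction rule: span_induct_alt)
    case base
    then show ?case by (rule br_zero_left)
  next
    case (step k x y)
    then obtain b c where "x = br b c" by auto
    then have "br x a = 0" using leibniz[of b c a] right0 by simp
    then show ?case using step by (simp add: br_add_left br_scale_left)
  qed
qed

text \<open>The line of \<open>v\<close> is an ideal because all products with \<open>v\<close>
  vanish. For a complement, extend \<open>v\<close>, \<open>z\<close> to a basis and drop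
  \<open>v\<close>: a subspace that contains \<open>z\<close> contains all products and is therefore
  an ideal.\<close>

lemma splitI:
  assumes br2: "\<And>a b. br a b \<in> span {z}" and z: "z \<noteq> 0"
    and v: "v \<notin> span {z}" "\<And>a. br a v = 0" "\<And>a. br v a = 0"
  shows split
proof -
  have "independent {v, z}"
    by (intro independent_insertI v) (simp_all add: z independent_empty)
  then obtain B where B: "{v, z} \<subseteq> B" "independent B" "UNIV \<subseteq> span B"
    using maximal_independent_subset_extend[of "{v, z}" UNIV] by (metis subset_UNIV)
  define J where "J = span (B - {v})"
  have "z \<noteq> v" using v(1) by (auto intro: span_base)
  then have zJ: "span {z} \<subseteq> J" unfolding J_def using B(1) by (intro span_mono) auto
  have vJ: "v \<notin> J" using B(1,2) unfolding J_def dependent_def by auto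
  have J: "ideal J"
    unfolding ideal_def using br2 zJ by (auto simp: J_def)
  have "br a i = 0 \<and> br i a = 0" if "i \<in> span {v}" for a i
    using that by (auto simp: span_singleton br_scale_left br_scale_right v)
  then have I: "ideal (span {v})"
    unfolding ideal_def by (auto simp: span_zero)
  have "span {v} \<inter> J = {0}"
  proof -
    have "x = 0" if x: "x \<in> span {v}" "x \<in> J" for x
    proof (rule ccontr)
      assume "x \<noteq> 0"
      obtain k where k: "x = scale k v" using x(1) by (auto simp: span_singleton)
      have "scale (1 / k) x \<in> J" using x(2) unfolding J_def by (rule span_scale)
      then show False using k vJ \<open>x \<noteq> 0\<close> by auto
    qed
    then show ?thesis by (auto simp: J_def span_zero)
  qed
  moreover have "{i + j |i j. i \<in> span {v} \<and> j \<in> J} = UNIV"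
  proof -
    have "span ({v} \<union> (B - {v})) = UNIV" using B(1,3) by (auto simp: insert_absorb)
    then show ?thesis unfolding J_def span_Un by simp
  qed
  moreover have "span {v} \<noteq> {0}" using v(1) span_zero span_base[of v "{v}"] by fastforce
  moreover have "J \<noteq> {0}" using zJ z span_base[of z "{z}"] by fastforce
  ultimately show ?thesis unfolding split_def using I J by blast
qed

text \<open>The coefficient of \<open>z\<close> in a product is unique, so bilinearity passes from
  \<open>br\<close> to \<open>f\<close>. Centrality puts \<open>z\<close> into the radical, and a
  radical vector outside \<open>span {z}\<close> would split the algebra.\<close>

lemma radical_form_exists:
  assumes nil: nilpotent and ns: "\<not> split"
    and dim4: "dim (UNIV :: 'a set) = 4" and dim1: "dim (lower_central 2) = 1"
  obtains f z where "radical_form scale f z" "\<And>a b. br a b = scale (f a b) z"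
proof -
  obtain Z where Z: "Z \<subseteq> lower_central 2" "independent Z" "lower_central 2 \<subseteq> span Z" "card Z = 1"
    using basis_exists[of "lower_central 2"] dim1 by metis
  obtain z where z: "Z = {z}" using Z(4) card_1_singletonE by blast
  have z0: "z \<noteq> 0" using Z(2) z dependent_zero by auto
  have "span Z \<subseteq> lower_central 2"
    using Z(1) unfolding lower_central_2 by (rule span_minimal) (rule subspace_span)
  then have lc: "lower_central 2 = span {z}" using Z(3) z by auto
  have br2: "br a b \<in> span {z}" for a b
    unfolding lc[symmetric] lower_central_2 by (rule span_base) auto
  define f where "f a b = (SOME k. br a b = scale k z)" for a b
  have f: "br a b = scale (f a b) z" for a b
    unfolding f_def by (rule someI_ex) (use br2[of a b] in \<open>auto simp: span_singleton\<close>)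
  have f0: "f a b = k" if "br a b = scale k z" for a b k
    using that f[of a b] z0 by auto
  note central = br_central[OF nil z0 lc]
  have "radical_form scale f z"
  proof
    fix a b c :: 'a and k :: complex
    show "f (a + b) c = f a c + f b c" "f c (a + b) = f c a + f c b"
      by (rule f0, simp add: br_add_left br_add_right f[of a c] f[of b c] f[of c a] f[of c b] scale_left_distrib)+
    show "f (scale k a) c = k * f a c" "f c (scale k a) = k * f c a"
      by (rule f0, simp add: br_scale_left br_scale_right f[of a c] f[of c a])+
  next
    fix v
    show "(\<forall>a. f v a = 0 \<and> f a v = 0) \<longleftrightarrow> v \<in> span {z}"
    proof
      assume "\<forall>a. f v a = 0 \<and> f a v = 0"
      then show "v \<in> span {z}" using splitI[OF br2 z0, of v] ns by (auto simp: f)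
    next
      assume "v \<in> span {z}"
      then obtain k where k: "v = scale k z" by (auto simp: span_singleton)
      show "\<forall>a. f v a = 0 \<and> f a v = 0"
        by (intro allI conjI f0) (simp_all add: k br_scale_left br_scale_right central)
    qed
  qed (use z0 dim4 in auto)
  then show thesis using that f by blast
qed

end

section \<open>Transport to coordinate space\<close>

text \<open>The product \<open>br'\<close> is defined so that \<open>h\<close> becomes an
  isomorphism; bases and multiplication tables then move along \<open>h\<close>.\<close>

lemma leibniz_algebra_transport:
  fixes s :: "complex \<Rightarrow> 'a::ab_group_add \<Rightarrow> 'a" and s' :: "complex \<Rightarrow> 'b::ab_group_add \<Rightarrow> 'b"
  assumes "leibniz_algebra s br" and lin: "Vector_Spaces.linear s s' h" and h: "bij h"
  defines "br' \<equiv> \<lambda>u v. h (br (inv h u) (inv h v))"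
  shows "leibniz_algebra s' br'"
    and "leibniz_isomorphic s br s' br'"
    and "leibniz_algebra.basis4 s x \<Longrightarrow> leibniz_algebra.basis4 s' (h \<circ> x)"
    and "leibniz_algebra.has_products s br x t \<Longrightarrow> leibniz_algebra.has_products s' br' (h \<circ> x) t"
proof -
  interpret A: leibniz_algebra s br by fact
  interpret h: Vector_Spaces.linear s s' h by fact
  have inv: "inv h (h a) = a" "h (inv h u) = u" for a u
    using h by (simp_all add: bij_is_inj bij_is_surj surj_f_inv_f)
  have inv_add: "inv h (u + v) = inv h u + inv h v" for u v
    by (metis inv h.add)
  have inv_scale: "inv h (s' k u) = s k (inv h u)" for k u
    by (metis inv h.scale)
  show B: "leibniz_algebra s' br'"
  proof (intro leibniz_algebra.intro leibniz_algebra_axioms.intro)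
    show "vector_space s'" by (rule h.vs2.vector_space_axioms)
    show "Vector_Spaces.linear s' s' (br' a)" for a
      unfolding Vector_Spaces.linear_iff br'_def
      by (simp add: h.vs2.vector_space_axioms inv_add inv_scale A.br_add_right A.br_scale_right h.add h.scale)
    show "Vector_Spaces.linear s' s' (\<lambda>a. br' a b)" for b
      unfolding Vector_Spaces.linear_iff br'_def
      by (simp add: h.vs2.vector_space_axioms inv_add inv_scale A.br_add_left A.br_scale_left h.add h.scale)
    show "br' a (br' b c) = br' (br' a b) c + br' b (br' a c)" for a b c
      unfolding br'_def inv by (subst A.leibniz) (rule h.add)
  qed
  interpret B: leibniz_algebra s' br' by (rule B)
  show "leibniz_isomorphic s br s' br'"
    unfolding leibniz_isomorphic_def br'_def using lin h by (auto simp: inv intro!: exI[of _ h])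
  show "B.basis4 (h \<circ> x)" if "A.basis4 x"
  proof -
    have "inj h" using h by (rule bij_is_inj)
    then have "h.vs2.independent (h ` x ` {1..4})"
      using that h.independent_injective_image inj_on_subset unfolding A.basis4_def by blast
    moreover have "h.vs2.span (h ` x ` {1..4}) = UNIV"
      using that h unfolding A.basis4_def h.span_image by (simp add: bij_is_surj)
    moreover have "inj_on (h \<circ> x) {1..4}"
      using that \<open>inj h\<close> unfolding A.basis4_def by (auto intro: comp_inj_on inj_on_subset)
    ultimately show ?thesis unfolding B.basis4_def image_comp by blast
  qed
  show "B.has_products (h \<circ> x) t" if "A.has_products x t"
    using that unfolding A.has_products_def B.has_products_def
    by (auto simp: br'_def inv h.scale h.zero split: option.split)
qed

text \<open>Both spaces have bases of four vectors, and a bijection between the bases extends to a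
  linear one between the spaces.\<close>

lemma linear_bij_vec4:
  fixes s :: "'k::field \<Rightarrow> 'a::ab_group_add \<Rightarrow> 'a"
  assumes "vector_space s" and "vector_space.dim s (UNIV :: 'a set) = 4"
  obtains h :: "'a \<Rightarrow> 'k ^ 4" where "Vector_Spaces.linear s (*s) h" "bij h"
proof -
  interpret V: vector_space s by fact
  interpret vector_space_pair s "(*s) :: 'k \<Rightarrow> 'k ^ 4 \<Rightarrow> 'k ^ 4" ..
  obtain B where B: "B \<subseteq> UNIV" "V.independent B" "UNIV \<subseteq> V.span B" "card B = V.dim UNIV"
    using V.basis_exists[of UNIV] by metis
  obtain C :: "('k ^ 4) set" where C: "C \<subseteq> UNIV" "vec.independent C" "UNIV \<subseteq> vec.span C"
    "card C = vec.dim (UNIV :: ('k ^ 4) set)"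
    using vec.basis_exists[of "UNIV :: ('k ^ 4) set"] by metis
  have d: "vec.dim (UNIV :: ('k ^ 4) set) = 4" unfolding vec_dim_card by simp
  have "finite B" "finite C"
    using B(4) C(4) assms d card.infinite by fastforce+
  then have "\<exists>h. Vector_Spaces.linear s (*s) h \<and> h ` B = C \<and> h ` UNIV = UNIV \<and> inj_on h UNIV"
    using assms(2) d B C by (intro finite_basis_to_basis_subspace_isomorphism) simp_all
  then show thesis using that by (auto simp: bij_def)
qed

theorem theorem2p3:
  fixes scale :: "complex \<Rightarrow> 'a::ab_group_add \<Rightarrow> 'a"
    and br :: "'a \<Rightarrow> 'a \<Rightarrow> 'a"
  assumes "leibniz_algebra scale br"
    and "\<not> leibniz_algebra.split scale br"
    and "\<not> leibniz_algebra.lie scale br"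
    and "leibniz_algebra.nilpotent scale br"
    and "vector_space.dim scale (UNIV :: 'a set) = 4"
    and "vector_space.dim scale (leibniz_algebra.lower_central scale br 2) = 1"
  shows "\<exists>(B :: complex^4 \<Rightarrow> complex^4 \<Rightarrow> complex^4) (x :: nat \<Rightarrow> complex^4).
    leibniz_algebra (*s) B \<and> leibniz_isomorphic scale br (*s) B \<and> leibniz_algebra.basis4 (*s) x \<and>
    (leibniz_algebra.has_products (*s) B x [((1,3), 1), ((3,2), 1)] \<or>
     leibniz_algebra.has_products (*s) B x
       [((1,3), 1), ((2,2), 1), ((2,3), 1), ((3,1), 1), ((3,2), -1)] \<or>
     leibniz_algebra.has_products (*s) B x [((1,2), 1), ((2,1), -1), ((3,3), 1)] \<or>
     leibniz_algebra.has_products (*s) B x [((1,2), 1), ((2,1), -1), ((2,2), 1), ((3,3), 1)] \<or>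
     (\<exists>c. c \<notin> {1, -1} \<and>
        leibniz_algebra.has_products (*s) B x [((1,2), 1), ((2,1), c), ((3,3), 1)]) \<or>
     leibniz_algebra.has_products (*s) B x [((1,1), 1), ((2,2), 1), ((3,3), 1)])"
proof -
  interpret A: leibniz_algebra scale br by fact
  obtain f z where "radical_form scale f z" and br: "\<And>a b. br a b = scale (f a b) z"
    using A.radical_form_exists assms by blast
  then interpret F: radical_form scale f z by simp
  \<comment> \<open>As \<open>x 4\<close> is \<open>z\<close>, the values of \<open>f\<close> on the
    basis are the coefficients in the multiplication table.\<close>
  have has_products: "A.has_products x t" if "F.represents x t" for x t
    using that unfolding F.represents_def A.has_products_def
    by (auto simp: br split: option.split)
  have basis: "A.basis4 x" if "F.represents x t" for x t
    using that unfolding F.represents_def F.basis_def A.basis4_def by simp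
  obtain h :: "'a \<Rightarrow> complex^4" where h: "Vector_Spaces.linear scale (*s) h" "bij h"
    using linear_bij_vec4[OF A.vector_space_axioms assms(5)] by blast
  let ?B = "\<lambda>u v. h (br (inv h u) (inv h v))"
  note transport = leibniz_algebra_transport[OF assms(1) h]
  have model: "leibniz_algebra (*s) ?B \<and> leibniz_isomorphic scale br (*s) ?B \<and>
      leibniz_algebra.basis4 (*s) (h \<circ> x) \<and> leibniz_algebra.has_products (*s) ?B (h \<circ> x) t"
    if "F.represents x t" for x t
    using transport(1,2) transport(3)[OF basis[OF that]] transport(4)[OF has_products[OF that]] by blast
  obtain x where "F.represents x [((1,3), 1), ((3,2), 1)] \<or>
     F.represents x [((1,3), 1), ((2,2), 1), ((2,3), 1), ((3,1), 1), ((3,2), -1)] \<or>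
     F.represents x [((1,2), 1), ((2,1), -1), ((3,3), 1)] \<or>
     F.represents x [((1,2), 1), ((2,1), -1), ((2,2), 1), ((3,3), 1)] \<or>
     (\<exists>c. c \<notin> {1, -1} \<and> F.represents x [((1,2), 1), ((2,1), c), ((3,3), 1)]) \<or>
     F.represents x [((1,1), 1), ((2,2), 1), ((3,3), 1)]"
    using F.classification unfolding F.classified_def by blast
  then show ?thesis
    by (intro exI[of _ ?B] exI[of _ "h \<circ> x"]) (elim disjE exE conjE; drule model; blast)
qed

end
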